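(* Let $(X,\mathcal{T})$ be a topological space, let $\mathcal{M}\subseteq\mathcal{P}'(X)$ be a natural family, let $\mathcal{O}=\mathcal{O}_{\mathcal{T}}^{\mathcal{M}}$, and let $\tau\geq\aleph_0$ be a cardinal. Then $w(X,\mathcal{T})\leq\tau$ if and only if $w(\mathcal{M},\mathcal{O})\leq\tau$.
   Context: $\mathcal{P}'(X)$ is the set of all non-empty subsets of $X$. $\mathcal{M}$ is a natural family in $X$ if $\{x\}\in\mathcal{M}$ for every $x\in X$. For $A\subseteq X$, $A_{\mathcal{M}}^-=\{M\in\mathcal{M}\mid M\cap A\neq\emptyset\}$. $\mathcal{O}_{\mathcal{T}}^{\mathcal{M}}$ is the topology on $\mathcal{M}$ having $\{U_{\mathcal{M}}^-\mid U\in\mathcal{T}\}$ as a subbase (the lower Vietoris topology on $\mathcal{M}$). $w$ denotes the weight of a topological space, i.e. the smallest cardinality of a base. *)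

theory Defs
  imports "HOL-Analysis.Analysis"
begin

unbundle cardinal_syntax

definition natural_family :: "'a set \<Rightarrow> 'a set set \<Rightarrow> bool"
  where "natural_family X \<M> \<longleftrightarrow> (\<forall>x\<in>X. {x} \<in> \<M>)"

definition hits :: "'a set set \<Rightarrow> 'a set \<Rightarrow> 'a set set"
  where "hits \<M> A = {M \<in> \<M>. M \<inter> A \<noteq> {}}"

text \<open>The relativization to \<open>\<M>\<close> makes \<open>\<M>\<close> itself the intersection of the empty
  subfamily of the subbase, so that the carrier is always \<open>\<M>\<close>.\<close>

definition lower_vietoris :: "'a topology \<Rightarrow> 'a set set \<Rightarrow> 'a set topology"
  where "lower_vietoris T \<M> =
    topology (arbitrary union_of
      (finite intersection_of (\<lambda>S. S \<in> {hits \<M> U | U. openin T U}) relative_to \<M>))"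

lemma topspace_lower_vietoris: "topspace (lower_vietoris T \<M>) = \<M>"
  unfolding lower_vietoris_def by (rule topspace_subbase)

definition topology_base :: "'a topology \<Rightarrow> 'a set set \<Rightarrow> bool"
  where "topology_base T \<B> \<longleftrightarrow> openin T = arbitrary union_of (\<lambda>B. B \<in> \<B>)"

text \<open>Cardinals are represented by cardinal well-orders, determined up to \<open>=o\<close>;
  the weight is a least element, with respect to \<open>\<le>o\<close>, of the cardinals of the bases.\<close>

definition weight :: "'a topology \<Rightarrow> 'a set rel"
  where "weight T = (SOME r. r \<in> {|\<B>| | \<B>. topology_base T \<B>} \<and>
    (\<forall>r' \<in> {|\<B>| | \<B>. topology_base T \<B>}. r \<le>o r'))"

lemma topology_base_all_open: "topology_base T {U. openin T U}"
proof -
  have "openin T U = (arbitrary union_of (\<lambda>B. B \<in> {U. openin T U})) U" for U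
    by (auto simp: union_of_def arbitrary_def intro: exI[of _ "{U}"])
  then show ?thesis
    unfolding topology_base_def by blast
qed

lemma weight_attained: "\<exists>\<B>. topology_base T \<B> \<and> weight T = |\<B>|"
  and weight_minimal: "topology_base T \<B> \<Longrightarrow> weight T \<le>o |\<B>|"
proof -
  let ?R = "{|\<B>| | \<B>. topology_base T \<B>}"
  have "\<exists>r\<in>?R. \<forall>r'\<in>?R. r \<le>o r'"
    using topology_base_all_open[of T] by (intro exists_minim_Card_order) (auto simp: card_of_Card_order)
  then have "weight T \<in> ?R \<and> (\<forall>r'\<in>?R. weight T \<le>o r')"
    unfolding weight_def by (intro someI_ex[where P = "\<lambda>r. r \<in> ?R \<and> (\<forall>r'\<in>?R. r \<le>o r')"]) blast
  then show "\<exists>\<B>. topology_base T \<B> \<and> weight T = |\<B>|"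
    and "topology_base T \<B> \<Longrightarrow> weight T \<le>o |\<B>|"
    by auto
qed

end

theory Submission
  imports Defs
begin

text \<open>Both implications bound a weight by exhibiting a base of cardinality at most \<open>\<tau>\<close>.

  If \<open>\<B>\<close> is a base of \<open>T\<close>, then the sets \<open>hits \<M> B\<close> with \<open>B \<in> \<B>\<close> already form a subbase of the
  lower Vietoris topology, because \<open>hits \<M>\<close> commutes with unions (lemma
  \<open>lower_vietoris_base\<close>). A subbase of cardinality at most an infinite cardinal has at most that
  many finite subfamilies, so it yields a base bounded by the same cardinal
  (lemma \<open>weight_subbase_ordLeq\<close>).

  Conversely, when \<open>\<M>\<close> contains all singletons, \<open>x \<mapsto> {x}\<close> embeds the space into \<open>\<M>\<close>: the
  preimage of \<open>hits \<M> U\<close> is \<open>U\<close>. Weight does not increase when passing to the domain of such a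
  map, since the preimages of the members of a base form a base (lemma \<open>weight_initial_ordLeq\<close>).\<close>

lemma topology_base_iff:
  "topology_base T \<B> \<longleftrightarrow> (\<forall>B\<in>\<B>. openin T B) \<and>
    (\<forall>U x. openin T U \<and> x \<in> U \<longrightarrow> (\<exists>B\<in>\<B>. x \<in> B \<and> B \<subseteq> U))"
  unfolding topology_base_def openin_topology_base_unique by blast

lemma weight_ordLeq_iff: "weight T \<le>o r \<longleftrightarrow> (\<exists>\<B>. topology_base T \<B> \<and> |\<B>| \<le>o r)"
proof
  assume "weight T \<le>o r"
  then show "\<exists>\<B>. topology_base T \<B> \<and> |\<B>| \<le>o r"
    using weight_attained[of T] by auto
next
  assume "\<exists>\<B>. topology_base T \<B> \<and> |\<B>| \<le>o r"
  then show "weight T \<le>o r"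
    by (auto intro: ordLeq_transitive[OF weight_minimal])
qed

lemma topology_base_Union:
  assumes "topology_base T \<B>" and "openin T U"
  obtains \<U> where "\<U> \<subseteq> \<B>" and "U = \<Union>\<U>"
  using assms unfolding topology_base_def union_of_def by auto

text \<open>By \<open>cont\<close> and \<open>initial\<close>, \<open>T\<close> is the topology induced by \<open>f\<close>, so that pulling back a
  base of \<open>Y\<close> gives a base of \<open>T\<close> indexed by the same set.\<close>

lemma weight_initial_ordLeq:
  assumes cont: "continuous_map T Y f"
    and initial: "\<And>U. openin T U \<Longrightarrow> \<exists>V. openin Y V \<and> U = {x \<in> topspace T. f x \<in> V}"
    and "weight Y \<le>o r"
  shows "weight T \<le>o r"
proof -
  obtain \<B> where base: "topology_base Y \<B>" and card: "|\<B>| \<le>o r"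
    using assms(3) weight_ordLeq_iff by blast
  let ?pre = "\<lambda>V. {x \<in> topspace T. f x \<in> V}"
  have "topology_base T (?pre ` \<B>)"
    unfolding topology_base_iff
  proof (intro conjI allI impI ballI)
    fix B assume "B \<in> ?pre ` \<B>"
    then show "openin T B"
      using base cont by (auto simp: topology_base_iff continuous_map)
  next
    fix U x assume Ux: "openin T U \<and> x \<in> U"
    then obtain V where V: "openin Y V" "U = ?pre V"
      using initial by blast
    then obtain B where "B \<in> \<B>" "f x \<in> B" "B \<subseteq> V"
      using base Ux unfolding topology_base_iff by blast
    then show "\<exists>B\<in>?pre ` \<B>. x \<in> B \<and> B \<subseteq> U"
      using V Ux by (intro bexI[of _ "?pre B"]) auto
  qed
  moreover have "|?pre ` \<B>| \<le>o r"
    by (rule ordLeq_transitive[OF card_of_image card])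
  ultimately show ?thesis
    using weight_ordLeq_iff by blast
qed

text \<open>The sets of \<open>n + 1\<close> elements are obtained by inserting an element into a set of \<open>n\<close> elements,
  so by induction there are at most \<open>r\<close> of each finite size; there are countably many sizes.\<close>

lemma card_of_Fpow_ordLeq:
  assumes "Card_order r" and "natLeq \<le>o r" and "|A| \<le>o r"
  shows "|Fpow A| \<le>o r"
proof -
  have nat: "|UNIV :: nat set| \<le>o r"
    by (rule ordIso_ordLeq_trans[OF card_of_nat assms(2)])
  have inf: "infinite (Field r)"
    using infinite_iff_natLeq_ordLeq[of "Field r"]
      ordLeq_ordIso_trans[OF assms(2) ordIso_symmetric[OF card_of_Field_ordIso[OF assms(1)]]]
    by simp
  define C where "C n = {F. F \<subseteq> A \<and> finite F \<and> card F = n}" for n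
  have "|C n| \<le>o r" for n
  proof (induction n)
    case 0
    have "C 0 = (\<lambda>_. {}) ` {0 :: nat}"
      by (auto simp: C_def)
    then have "|C 0| \<le>o |{0 :: nat}|"
      by (simp only: card_of_image)
    then show ?case
      by (rule ordLeq_transitive[OF _ ordLeq_transitive[OF card_of_mono1[OF subset_UNIV] nat]])
  next
    case (Suc n)
    have "C (Suc n) \<subseteq> (\<lambda>(a, F). insert a F) ` (A \<times> C n)"
    proof
      fix F assume F: "F \<in> C (Suc n)"
      then obtain a G where "F = insert a G" "a \<notin> G" "card G = n"
        by (auto simp: C_def card_Suc_eq)
      then show "F \<in> (\<lambda>(a, F). insert a F) ` (A \<times> C n)"
        using F by (auto simp: C_def intro!: image_eqI[of _ _ "(a, G)"])
    qed
    then have "|C (Suc n)| \<le>o |A \<times> C n|"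
      by (rule ordLeq_transitive[OF card_of_mono1 card_of_image])
    also have "|A \<times> C n| \<le>o r"
      by (rule card_of_Times_ordLeq_infinite_Field[OF inf assms(3) Suc assms(1)])
    finally show ?case .
  qed
  then have "|\<Union>n. C n| \<le>o r"
    by (intro card_of_UNION_ordLeq_infinite_Field[OF inf assms(1) nat]) auto
  moreover have "Fpow A = (\<Union>n. C n)"
    by (auto simp: Fpow_def C_def)
  ultimately show ?thesis
    by simp
qed

lemma openin_subbase_member:
  assumes "S \<in> \<S>" and "S \<subseteq> Y"
  shows "openin (topology (arbitrary union_of
    (finite intersection_of (\<lambda>S. S \<in> \<S>) relative_to Y))) S"
proof -
  have "(finite intersection_of (\<lambda>S. S \<in> \<S>)) S"
    by (rule finite_intersection_of_inc) (rule assms(1))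
  then have "(finite intersection_of (\<lambda>S. S \<in> \<S>) relative_to Y) (Y \<inter> S)"
    by (rule relative_to_inc)
  moreover have "Y \<inter> S = S"
    using assms(2) by blast
  ultimately show ?thesis
    unfolding openin_subbase by (simp add: arbitrary_union_of_inc)
qed

lemma weight_subbase_ordLeq:
  assumes "Card_order r" and "natLeq \<le>o r" and "|\<S>| \<le>o r"
  shows "weight (topology (arbitrary union_of
    (finite intersection_of (\<lambda>S. S \<in> \<S>) relative_to Y))) \<le>o r"
proof -
  let ?\<B> = "(\<lambda>\<F>. Y \<inter> \<Inter>\<F>) ` Fpow \<S>"
  have "(finite intersection_of (\<lambda>S. S \<in> \<S>) relative_to Y) = (\<lambda>B. B \<in> ?\<B>)"
    by (auto simp: fun_eq_iff relative_to_def intersection_of_def Fpow_def)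
  then have "topology_base (topology (arbitrary union_of
      (finite intersection_of (\<lambda>S. S \<in> \<S>) relative_to Y))) ?\<B>"
    unfolding topology_base_def by (metis istopology_subbase topology_inverse')
  moreover have "|?\<B>| \<le>o r"
    by (rule ordLeq_transitive[OF card_of_image card_of_Fpow_ordLeq[OF assms]])
  ultimately show ?thesis
    using weight_ordLeq_iff by blast
qed

lemma hits_Union: "hits \<M> (\<Union>\<U>) = (\<Union>U\<in>\<U>. hits \<M> U)"
  by (auto simp: hits_def)

lemma openin_lower_vietoris_hits:
  assumes "openin T U"
  shows "openin (lower_vietoris T \<M>) (hits \<M> U)"
  unfolding lower_vietoris_def
  by (rule openin_subbase_member) (use assms in \<open>auto simp: hits_def\<close>)

text \<open>Only the members of a base are needed to generate the topology: every other \<open>hits \<M> U\<close> is a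
  union of sets \<open>hits \<M> B\<close>.\<close>

lemma lower_vietoris_base:
  assumes "topology_base T \<B>"
  shows "lower_vietoris T \<M> = topology (arbitrary union_of
    (finite intersection_of (\<lambda>S. S \<in> hits \<M> ` \<B>) relative_to \<M>))" (is "_ = ?O")
proof -
  have "openin ?O S" if "openin (lower_vietoris T \<M>) S" for S
  proof (rule minimal_topology_subbase[OF _ _ that[unfolded lower_vietoris_def]])
    have sub: "openin ?O (hits \<M> B)" if "B \<in> \<B>" for B
      by (rule openin_subbase_member) (use that in \<open>auto simp: hits_def\<close>)
    fix S assume "S \<in> {hits \<M> U | U. openin T U}"
    then obtain U where "openin T U" and S: "S = hits \<M> U"
      by blast
    then obtain \<U> where "\<U> \<subseteq> \<B>" "U = \<Union>\<U>"
      using topology_base_Union[OF assms] by blast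
    then show "openin ?O S"
      using sub unfolding S by (auto simp: hits_Union)
  next
    show "openin ?O \<M>"
      using openin_topspace[of ?O] by simp
  qed
  moreover have "openin (lower_vietoris T \<M>) S" if "openin ?O S" for S
  proof (rule minimal_topology_subbase[OF _ _ that])
    fix S assume "S \<in> hits \<M> ` \<B>"
    then show "openin (lower_vietoris T \<M>) S"
      using assms openin_lower_vietoris_hits by (auto simp: topology_base_iff)
  next
    show "openin (lower_vietoris T \<M>) \<M>"
      using openin_topspace[of "lower_vietoris T \<M>"] by (simp add: topspace_lower_vietoris)
  qed
  ultimately show ?thesis
    unfolding topology_eq by blast
qed

lemma singleton_mem_hits:
  assumes "natural_family X \<M>" and "x \<in> X"
  shows "{x} \<in> hits \<M> U \<longleftrightarrow> x \<in> U"
  using assms by (auto simp: natural_family_def hits_def)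

lemma continuous_map_singleton:
  assumes "natural_family (topspace T) \<M>"
  shows "continuous_map T (lower_vietoris T \<M>) (\<lambda>x. {x})"
  unfolding lower_vietoris_def
proof (rule continuous_map_into_topology_subbase)
  fix x assume "x \<in> topspace T"
  then show "{x} \<in> topspace (topology (arbitrary union_of
      (finite intersection_of (\<lambda>S. S \<in> {hits \<M> U | U. openin T U}) relative_to \<M>)))"
    using assms by (simp add: natural_family_def)
next
  fix S assume "S \<in> {hits \<M> U | U. openin T U}"
  then obtain U where U: "openin T U" "S = hits \<M> U"
    by blast
  then have "{x \<in> topspace T. {x} \<in> S} = U"
    using openin_subset singleton_mem_hits[OF assms] by blast
  then show "openin T {x \<in> topspace T. {x} \<in> S}"
    using U by simp
qed

theorem proposition4p2:
  fixes T :: "'a topology" and \<M> :: "'a set set" and \<tau> :: "'c rel"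
  assumes "\<M> \<subseteq> Pow (topspace T) - {{}}"
    and "natural_family (topspace T) \<M>"
    and "Card_order \<tau>" and "natLeq \<le>o \<tau>"
  shows "weight T \<le>o \<tau> \<longleftrightarrow> weight (lower_vietoris T \<M>) \<le>o \<tau>"
proof
  assume "weight T \<le>o \<tau>"
  then obtain \<B> where \<B>: "topology_base T \<B>" "|\<B>| \<le>o \<tau>"
    using weight_ordLeq_iff by blast
  have "|hits \<M> ` \<B>| \<le>o \<tau>"
    by (rule ordLeq_transitive[OF card_of_image \<B>(2)])
  then show "weight (lower_vietoris T \<M>) \<le>o \<tau>"
    unfolding lower_vietoris_base[OF \<B>(1)] by (rule weight_subbase_ordLeq[OF assms(3,4)])
next
  assume "weight (lower_vietoris T \<M>) \<le>o \<tau>"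
  then show "weight T \<le>o \<tau>"
  proof (rule weight_initial_ordLeq[OF continuous_map_singleton[OF assms(2)], rotated])
    fix U assume U: "openin T U"
    then have "U = {x \<in> topspace T. {x} \<in> hits \<M> U}"
      using openin_subset singleton_mem_hits[OF assms(2)] by blast
    then show "\<exists>V. openin (lower_vietoris T \<M>) V \<and> U = {x \<in> topspace T. {x} \<in> V}"
      using U openin_lower_vietoris_hits by blast
  qed
qed

end
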